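(* Let $g$ be a convex, proper, lower semicontinuous function on $\mathbb{R}^n$, let $\gamma>0$, and let $\mathcal{M}=\{\mathcal{M}_1,\ldots,\mathcal{M}_m\}$ be a family of $m$ linear subspaces of $\mathbb{R}^n$. Let $(u^k)$ be an $\mathbb{R}^n$-valued (random) sequence converging almost surely to $u^\star$, and define $x^k=\mathbf{prox}_{\gamma g}(u^k)$ and $x^\star=\mathbf{prox}_{\gamma g}(u^\star)$. Then $(x^k)$ identifies some subspaces with probability one; more precisely, for any $\varepsilon>0$, with probability one, after some finite time (i.e. for all $k$ large enough), $$\mathsf{S}_{\mathcal{M}}(x^\star)\ \le\ \mathsf{S}_{\mathcal{M}}(x^k)\ \le\bigcup_{u\in\mathcal{B}(u^\star,\varepsilon)}\mathsf{S}_{\mathcal{M}}(\mathbf{prox}_{\gamma g}(u)).$$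
   Context: $\mathbf{prox}_{\gamma g}(x)=\mathrm{argmin}_{y\in\mathbb{R}^n}\{g(y)+\frac{1}{2\gamma}\|y-x\|_2^2\}$. $\mathcal{B}(u,\varepsilon)$ is the ball centered at $u$ of radius $\varepsilon$. The sparsity vector of $x\in\mathbb{R}^n$ on $\mathcal{M}$ is the vector $\mathsf{S}_{\mathcal{M}}(x)\in\{0,1\}^m$ with $[\mathsf{S}_{\mathcal{M}}(x)]_i=0$ if $x\in\mathcal{M}_i$ and $1$ otherwise. For $a,b\in\{0,1\}^m$: $a\le b$ means $[a]_i\le[b]_i$ for all $i$; the union $c=a\cup b$ is the vector with $[c]_i=1$ if $[a]_i=1$ or $[b]_i=1$, and $0$ otherwise (and similarly for arbitrary unions). *)

theory Defs
  imports "HOL-Probability.Probability"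
begin

text \<open>Under properness the convexity inequality in \<open>convex_fun\<close> never meets \<open>\<infinity> - \<infinity>\<close>; at the
  endpoints it relies on \<open>0 * \<infinity> = 0\<close> in \<^typ>\<open>ereal\<close>.\<close>

definition proper_fun :: "('a \<Rightarrow> ereal) \<Rightarrow> bool" where
  "proper_fun g \<longleftrightarrow> (\<forall>x. g x \<noteq> -\<infinity>) \<and> (\<exists>x. g x \<noteq> \<infinity>)"

definition convex_fun :: "('a::real_vector \<Rightarrow> ereal) \<Rightarrow> bool" where
  "convex_fun g \<longleftrightarrow>
    (\<forall>x y. \<forall>s\<ge>0. \<forall>t\<ge>0. s + t = 1 \<longrightarrow>
      g (s *\<^sub>R x + t *\<^sub>R y) \<le> ereal s * g x + ereal t * g y)"

definition lsc_fun :: "('a::topological_space \<Rightarrow> ereal) \<Rightarrow> bool" where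
  "lsc_fun g \<longleftrightarrow> (\<forall>x. g x \<le> Liminf (at x) g)"

definition prox :: "real \<Rightarrow> (real ^ 'n \<Rightarrow> ereal) \<Rightarrow> real ^ 'n \<Rightarrow> real ^ 'n" where
  "prox \<gamma> g x = (ARG_MIN (\<lambda>y. g y + ereal (1 / (2 * \<gamma>) * (norm (y - x))\<^sup>2)) y. True)"

text \<open>Vectors in \<open>{0,1}\<^sup>m\<close> are represented as \<^typ>\<open>nat ^ 'm\<close>; the library order on this type
  is the componentwise one (\<open>less_eq_vec_def\<close>).\<close>

definition sparsity :: "('m \<Rightarrow> (real ^ 'n) set) \<Rightarrow> real ^ 'n \<Rightarrow> nat ^ 'm" where
  "sparsity \<M> x = (\<chi> i. if x \<in> \<M> i then 0 else 1)"

definition sparsity_Union :: "(nat ^ 'm) set \<Rightarrow> nat ^ 'm" where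
  "sparsity_Union A = (\<chi> i. if \<exists>a\<in>A. a $ i = 1 then 1 else 0)"

end

theory Submission
  imports Defs
begin

text \<open>
  The objective \<open>y \<mapsto> g y + \<parallel>y - a\<parallel>\<^sup>2 / (2\<gamma>)\<close> has a minimiser: convexity propagates the bound that
  \<open>g\<close> has on one unit ball to an affine-in-the-norm minorant on the whole space, the quadratic term
  beats this minorant, and a lower semicontinuous function attains its infimum on a compact ball
  (\<open>prox_objective_has_minimiser\<close>). Hence the value selected by \<open>prox\<close> really is a minimiser. The
  variational inequalities of two minimisers, added together, make their distance at most the
  distance of the centres (\<open>proximal_points_nonexpansive\<close>). So the proximal map is continuous, and
  \<open>x\<^sup>k \<longlonglongrightarrow> x\<^sup>\<star>\<close> wherever \<open>u\<^sup>k \<longlonglongrightarrow> u\<^sup>\<star>\<close>.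

  The lower bound on the sparsity vector then says that the complement of each subspace is open: if
  \<open>x\<^sup>\<star>\<close> is outside one of the finitely many subspaces, so are nearby points. The upper bound
  holds because \<open>u\<^sup>k\<close> is itself eventually one of the points of the ball over which the union is
  taken.
\<close>

section \<open>Lower semicontinuous functions\<close>

lemma lsc_fun_open_superlevel:
  fixes f :: "'a::topological_space \<Rightarrow> ereal"
  assumes "lsc_fun f"
  shows "open {y. c < f y}"
proof (subst open_subopen, safe)
  fix y assume y: "c < f y"
  have "f y \<le> Liminf (at y) f"
    using assms unfolding lsc_fun_def ..
  then have "\<forall>\<^sub>F z in at y. c < f z"
    using y by (simp add: le_Liminf_iff)
  then obtain S where S: "open S" "y \<in> S" "\<forall>z\<in>S. z \<noteq> y \<longrightarrow> c < f z"
    by (auto simp: eventually_at_topological)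
  with y have "S \<subseteq> {y. c < f y}"
    by fastforce
  with S show "\<exists>T. open T \<and> y \<in> T \<and> T \<subseteq> {y. c < f y}"
    by blast
qed

text \<open>If no point of \<open>K\<close> were a minimiser, the superlevel sets \<open>{y. f z < f y}\<close> with \<open>z \<in> K\<close> would
  be an open cover of \<open>K\<close>. In a finite subcover the level point of least value is not covered.\<close>

lemma lsc_fun_attains_inf:
  fixes f :: "'a::topological_space \<Rightarrow> ereal"
  assumes "lsc_fun f" and "compact K" and "K \<noteq> {}"
  shows "\<exists>z\<in>K. \<forall>y\<in>K. f z \<le> f y"
proof (rule ccontr)
  assume "\<not> ?thesis"
  then have cover: "K \<subseteq> (\<Union>z\<in>K. {y. f z < f y})"
    by (auto simp: not_le)
  obtain C where C: "C \<subseteq> K" "finite C" "K \<subseteq> (\<Union>z\<in>C. {y. f z < f y})"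
    by (rule compactE_image[OF assms(2) lsc_fun_open_superlevel[OF assms(1)] cover]) (rule that)
  with assms(3) have "C \<noteq> {}" by auto
  with C(2) obtain z where z: "z \<in> C" "\<forall>y\<in>C. f z \<le> f y"
    using ex_is_arg_min_if_finite[of C f] by (auto simp: is_arg_min_linorder)
  from z(1) C obtain w where "w \<in> C" "f w < f z"
    by blast
  with z(2) show False
    by (simp add: leD)
qed

lemma lsc_fun_add_continuous:
  fixes g :: "'a::topological_space \<Rightarrow> ereal" and h :: "'a \<Rightarrow> real"
  assumes "lsc_fun g" and "continuous_on UNIV h"
  shows "lsc_fun (\<lambda>y. g y + ereal (h y))"
  unfolding lsc_fun_def le_Liminf_iff
proof (intro allI impI)
  fix y c assume "c < g y + ereal (h y)"
  then have "c - ereal (h y) < g y"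
    by (subst ereal_minus_less) auto
  \<comment> \<open>A real threshold strictly between the two sides leaves room for \<open>h\<close> to vary near \<open>y\<close>.\<close>
  then obtain d where d: "c - ereal (h y) < ereal d" "ereal d < g y"
    using ereal_dense2 by blast
  have "\<forall>\<^sub>F z in at y. ereal d < g z"
    using assms(1) d(2) unfolding lsc_fun_def le_Liminf_iff by blast
  moreover have "\<forall>\<^sub>F z in at y. c < ereal (d + h z)"
  proof (rule order_tendstoD(1))
    have "(h \<longlongrightarrow> h y) (at y)"
      using assms(2) by (simp add: continuous_on_def)
    then show "((\<lambda>z. ereal (d + h z)) \<longlongrightarrow> ereal (d + h y)) (at y)"
      by (intro tendsto_intros)
    show "c < ereal (d + h y)"
      using d(1) by (subst (asm) ereal_minus_less) auto
  qed
  ultimately show "\<forall>\<^sub>F z in at y. c < g z + ereal (h z)"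
  proof eventually_elim
    case (elim z)
    have "ereal d + ereal (h z) \<le> g z + ereal (h z)"
      using elim by (intro add_right_mono) simp
    with elim show ?case by simp
  qed
qed

section \<open>Existence of proximal points\<close>

text \<open>Let \<open>m\<close> be the minimum of \<open>g\<close> on the unit ball around a point \<open>x0\<close> of the domain. The segment
  from \<open>x0\<close> to a far point \<open>y\<close> crosses the unit sphere at a point where \<open>g\<close> is at least \<open>m\<close>, so by
  convexity \<open>g\<close> decreases along that segment at rate at most \<open>g x0 - m\<close>. This replaces the affine
  minorant that a separating hyperplane would give.\<close>

lemma convex_lsc_norm_minorant:
  fixes g :: "'a::euclidean_space \<Rightarrow> ereal"
  assumes cvx: "convex_fun g" and proper: "proper_fun g" and lsc: "lsc_fun g"
    and x0: "g x0 \<noteq> \<infinity>"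
  obtains m C where "C \<ge> 0" "\<And>y. ereal (m - C * norm (y - x0)) \<le> g y"
proof -
  have fin: "g y \<noteq> -\<infinity>" for y
    using proper by (auto simp: proper_fun_def)
  obtain c where c: "g x0 = ereal c"
    using x0 fin by (cases "g x0") auto
  obtain z where z: "z \<in> cball x0 1" "\<forall>y\<in>cball x0 1. g z \<le> g y"
    using lsc_fun_attains_inf[OF lsc, of "cball x0 1"] by auto
  have "g z \<le> ereal c"
    using z(2) c by (metis centre_in_cball zero_le_one)
  then obtain m where m: "g z = ereal m" "m \<le> c"
    using fin by (cases "g z") auto
  have "ereal (m - (c - m) * norm (y - x0)) \<le> g y" for y
  proof (cases "norm (y - x0) \<le> 1")
    case True
    then have "ereal m \<le> g y"
      using z(2) m(1) by (auto simp: dist_norm norm_minus_commute)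
    moreover have "m - (c - m) * norm (y - x0) \<le> m"
      using m(2) by simp
    ultimately show ?thesis
      by (meson ereal_less_eq(3) order_trans)
  next
    case False
    define r where "r = norm (y - x0)"
    define w where "w = (1 - 1/r) *\<^sub>R x0 + (1/r) *\<^sub>R y"
    have r: "r > 1" using False by (simp add: r_def)
    have "w - x0 = (1/r) *\<^sub>R (y - x0)"
      by (simp add: w_def algebra_simps)
    then have "norm (w - x0) = 1"
      using r by (simp flip: r_def)
    then have "ereal m \<le> g w"
      using z(2) m(1) by (auto simp: dist_norm norm_minus_commute)
    also have "g w \<le> ereal (1 - 1/r) * g x0 + ereal (1/r) * g y"
      unfolding w_def using r by (intro cvx[unfolded convex_fun_def, rule_format]) auto
    finally have le: "ereal m \<le> ereal (1 - 1/r) * ereal c + ereal (1/r) * g y"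
      by (simp add: c)
    show ?thesis
    proof (cases "g y")
      case (real d)
      have "m \<le> (1 - 1/r) * c + (1/r) * d"
        using le real by simp
      then have "r * m \<le> r * ((1 - 1/r) * c + (1/r) * d)"
        using r by (intro mult_left_mono) auto
      also have "\<dots> = (r - 1) * c + d"
        using r by (simp add: field_simps)
      finally show ?thesis
        using real m(2) by (simp add: algebra_simps flip: r_def)
    qed (use fin in auto)
  qed
  with m(2) show thesis
    by (intro that[of "c - m" m]) auto
qed

text \<open>Outside a sufficiently large ball around a point \<open>x0\<close> of the domain the objective exceeds its
  value at \<open>x0\<close>, so a minimiser over that ball is a global one.\<close>

lemma prox_objective_has_minimiser:
  fixes g :: "'a::euclidean_space \<Rightarrow> ereal"
  assumes cvx: "convex_fun g" and proper: "proper_fun g" and lsc: "lsc_fun g"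
    and \<gamma>: "\<gamma> > 0"
  shows "\<exists>p. \<forall>y. g p + ereal (1 / (2 * \<gamma>) * (norm (p - a))\<^sup>2)
    \<le> g y + ereal (1 / (2 * \<gamma>) * (norm (y - a))\<^sup>2)"
proof -
  define f where "f = (\<lambda>y. g y + ereal (1 / (2 * \<gamma>) * (norm (y - a))\<^sup>2))"
  obtain x0 where x0: "g x0 \<noteq> \<infinity>" and fin: "\<And>y. g y \<noteq> -\<infinity>"
    using proper by (auto simp: proper_fun_def)
  then obtain c where c: "g x0 = ereal c"
    by (cases "g x0") auto
  obtain m C where C: "C \<ge> 0" and min: "\<And>y. ereal (m - C * norm (y - x0)) \<le> g y"
    by (rule convex_lsc_norm_minorant[OF cvx proper lsc x0]) (rule that)
  define s where "s = norm (x0 - a)"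
  \<comment> \<open>For \<open>t = \<parallel>y - x0\<parallel>\<close> it suffices that \<open>2\<gamma>(c - m + C t) + s\<^sup>2 < (t - s)\<^sup>2\<close>. Expanding the square, the
    terms other than \<open>t\<^sup>2\<close> amount to at most \<open>K t\<close> once \<open>t \<ge> 1\<close>, and \<open>K < t\<close> finishes.\<close>
  define K where "K = 2 * \<gamma> * (C + \<bar>c\<bar> + \<bar>m\<bar> + 1) + s\<^sup>2 + 2 * s"
  define R where "R = K + 1"
  have s: "s \<ge> 0" by (simp add: s_def)
  have K: "K \<ge> 0" using C \<gamma> s by (simp add: K_def)
  have far: "f x0 < f y" if "norm (y - x0) > R" for y
  proof -
    define t where "t = norm (y - x0)"
    have t: "t > R" "t \<ge> 1" using that K by (auto simp: t_def R_def)
    have "t \<le> norm (y - a) + s"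
      unfolding t_def s_def using norm_triangle_ineq4[of "y - a" "x0 - a"] by simp
    moreover have "t \<ge> s"
    proof -
      have "2 * \<gamma> * (C + \<bar>c\<bar> + \<bar>m\<bar> + 1) \<ge> 0" using \<gamma> C by simp
      then have "K \<ge> s" using s by (simp add: K_def add_increasing)
      then show ?thesis using t by (simp add: R_def)
    qed
    ultimately have sq: "(t - s)\<^sup>2 \<le> (norm (y - a))\<^sup>2"
      by (intro power_mono) auto
    have "K * t < t * t"
      using t by (intro mult_strict_right_mono) (auto simp: R_def)
    moreover have "2 * \<gamma> * (C * t + \<bar>c\<bar> + \<bar>m\<bar>) + s\<^sup>2 + 2 * s * t \<le> K * t"
    proof -
      have "\<bar>c\<bar> + \<bar>m\<bar> \<le> (\<bar>c\<bar> + \<bar>m\<bar> + 1) * t"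
        using mult_left_mono[OF t(2), of "\<bar>c\<bar> + \<bar>m\<bar> + 1"] by simp
      then have "2 * \<gamma> * (C * t + \<bar>c\<bar> + \<bar>m\<bar>) \<le> 2 * \<gamma> * (C * t + (\<bar>c\<bar> + \<bar>m\<bar> + 1) * t)"
        using \<gamma> by simp
      moreover have "s\<^sup>2 \<le> s\<^sup>2 * t"
        using mult_left_mono[OF t(2), of "s\<^sup>2"] by simp
      ultimately show ?thesis
        by (simp add: K_def algebra_simps)
    qed
    ultimately have "2 * \<gamma> * (c - m + C * t) + s\<^sup>2 < (t - s)\<^sup>2"
    proof -
      assume *: "K * t < t * t"
        "2 * \<gamma> * (C * t + \<bar>c\<bar> + \<bar>m\<bar>) + s\<^sup>2 + 2 * s * t \<le> K * t"
      have "2 * \<gamma> * (c - m + C * t) \<le> 2 * \<gamma> * (C * t + \<bar>c\<bar> + \<bar>m\<bar>)"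
        using \<gamma> by (intro mult_left_mono) auto
      moreover have "(t - s)\<^sup>2 = t * t - 2 * s * t + s\<^sup>2"
        by (simp add: power2_eq_square algebra_simps)
      moreover have "s\<^sup>2 \<ge> 0" by simp
      ultimately show ?thesis using * by linarith
    qed
    then have "2 * \<gamma> * (c - m + C * t) + s\<^sup>2 < (norm (y - a))\<^sup>2"
      using sq by linarith
    then have "(2 * \<gamma> * (c - m + C * t) + s\<^sup>2) / (2 * \<gamma>) < (norm (y - a))\<^sup>2 / (2 * \<gamma>)"
      by (rule divide_strict_right_mono) (use \<gamma> in simp)
    moreover have "(2 * \<gamma> * (c - m + C * t) + s\<^sup>2) / (2 * \<gamma>)
        = c - m + C * t + 1 / (2 * \<gamma>) * s\<^sup>2"
      by (subst add_divide_distrib) (use \<gamma> in simp)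
    ultimately have "c + 1 / (2 * \<gamma>) * s\<^sup>2 < (m - C * t) + 1 / (2 * \<gamma>) * (norm (y - a))\<^sup>2"
      by simp
    then have "f x0 < ereal (m - C * t) + ereal (1 / (2 * \<gamma>) * (norm (y - a))\<^sup>2)"
      unfolding f_def c s_def by simp
    also have "\<dots> \<le> f y"
      unfolding f_def t_def by (intro add_right_mono min)
    finally show ?thesis .
  qed
  have "lsc_fun f"
    unfolding f_def by (rule lsc_fun_add_continuous[OF lsc]) (intro continuous_intros)
  moreover have x0_in: "x0 \<in> cball x0 R"
    using K by (simp add: R_def)
  ultimately obtain p where p: "\<forall>y\<in>cball x0 R. f p \<le> f y"
    using lsc_fun_attains_inf[of f "cball x0 R"] compact_cball[of x0 R] by blast
  have "f p \<le> f y" for y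
  proof (cases "y \<in> cball x0 R")
    case True
    with p show ?thesis by blast
  next
    case False
    then have "f x0 < f y"
      by (intro far) (simp add: dist_norm norm_minus_commute)
    with p x0_in show ?thesis
      by (meson less_imp_le order_trans)
  qed
  then have "\<forall>y. f p \<le> f y" ..
  then show ?thesis
    unfolding f_def by (rule exI)
qed

section \<open>Nonexpansiveness of the proximal map\<close>

text \<open>First-order optimality of \<open>p\<close> tested against \<open>q\<close>: compare \<open>p\<close> with the points
  \<open>p + t(q - p)\<close>, bound \<open>g\<close> there by convexity, divide by \<open>t\<close> and let \<open>t\<close> tend to \<open>0\<close>. This is the
  inclusion \<open>(a - p)/\<gamma> \<in> \<partial>g(p)\<close> without subdifferentials.\<close>

lemma proximal_point_variational_inequality:
  fixes g :: "'a::real_inner \<Rightarrow> ereal"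
  assumes cvx: "convex_fun g" and \<gamma>: "\<gamma> > 0"
    and p: "\<And>y. g p + ereal (1 / (2 * \<gamma>) * (norm (p - a))\<^sup>2)
      \<le> g y + ereal (1 / (2 * \<gamma>) * (norm (y - a))\<^sup>2)"
    and gp: "g p = ereal c" and gq: "g q = ereal d"
  shows "c \<le> d + (1 / \<gamma>) * inner (p - a) (q - p)"
proof -
  define B where "B = (1 / \<gamma>) * inner (p - a) (q - p)"
  define D where "D = (1 / (2 * \<gamma>)) * (norm (q - p))\<^sup>2"
  have ineq: "c \<le> d + B + t * D" if t: "0 < t" "t \<le> 1" for t :: real
  proof -
    define z where "z = (1 - t) *\<^sub>R p + t *\<^sub>R q"
    have "g z \<le> ereal (1 - t) * g p + ereal t * g q"
      unfolding z_def using t by (intro cvx[unfolded convex_fun_def, rule_format]) auto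
    then have gz: "g z \<le> ereal ((1 - t) * c + t * d)"
      by (simp add: gp gq)
    have "ereal (c + 1 / (2 * \<gamma>) * (norm (p - a))\<^sup>2)
        \<le> g z + ereal (1 / (2 * \<gamma>) * (norm (z - a))\<^sup>2)"
      using p[of z] by (simp add: gp)
    also have "\<dots> \<le> ereal ((1 - t) * c + t * d) + ereal (1 / (2 * \<gamma>) * (norm (z - a))\<^sup>2)"
      by (intro add_right_mono gz)
    finally have "c + 1 / (2 * \<gamma>) * (norm (p - a))\<^sup>2
        \<le> (1 - t) * c + t * d + 1 / (2 * \<gamma>) * (norm (z - a))\<^sup>2"
      by simp
    moreover have "(norm (z - a))\<^sup>2
        = (norm (p - a))\<^sup>2 + 2 * t * inner (p - a) (q - p) + t\<^sup>2 * (norm (q - p))\<^sup>2"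
    proof -
      have "z - a = (p - a) + t *\<^sub>R (q - p)"
        by (simp add: z_def algebra_simps)
      then show ?thesis
        by (simp only: power2_norm_eq_inner inner_add_left inner_add_right inner_scaleR_left
            inner_scaleR_right inner_commute[of "q - p" "p - a"])
          (simp add: power2_eq_square distrib_left)
    qed
    then have "1 / (2 * \<gamma>) * (norm (z - a))\<^sup>2
        = 1 / (2 * \<gamma>) * (norm (p - a))\<^sup>2 + t * B + t * (t * D)"
      using \<gamma> by (simp add: B_def D_def field_simps power2_eq_square)
    ultimately have "t * c \<le> t * (d + B + t * D)"
      by (simp add: algebra_simps)
    with t show ?thesis by simp
  qed
  have "c \<le> d + B + 0 * D"
  proof (rule tendsto_lowerbound[where F = "at_right (0::real)"])
    show "((\<lambda>t. d + B + t * D) \<longlongrightarrow> d + B + 0 * D) (at_right 0)"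
      by (intro tendsto_intros)
    show "\<forall>\<^sub>F t in at_right 0. c \<le> d + B + t * D"
      unfolding eventually_at_right_field using ineq by (intro exI[of _ 1]) auto
  qed simp
  then show ?thesis by (simp add: B_def)
qed

text \<open>The variational inequalities of \<open>p\<close> and \<open>q\<close> add up to
  \<open>\<parallel>p - q\<parallel>\<^sup>2 \<le> (a - b) \<bullet> (p - q)\<close>, and the Cauchy-Schwarz inequality does the rest. With
  \<open>a = b\<close> this is also uniqueness of the minimiser.\<close>

lemma proximal_points_nonexpansive:
  fixes g :: "'a::real_inner \<Rightarrow> ereal"
  assumes cvx: "convex_fun g" and proper: "proper_fun g" and \<gamma>: "\<gamma> > 0"
    and p: "\<And>y. g p + ereal (1 / (2 * \<gamma>) * (norm (p - a))\<^sup>2)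
      \<le> g y + ereal (1 / (2 * \<gamma>) * (norm (y - a))\<^sup>2)"
    and q: "\<And>y. g q + ereal (1 / (2 * \<gamma>) * (norm (q - b))\<^sup>2)
      \<le> g y + ereal (1 / (2 * \<gamma>) * (norm (y - b))\<^sup>2)"
  shows "dist p q \<le> dist a b"
proof -
  obtain x0 where x0: "g x0 \<noteq> \<infinity>" and fin: "\<And>y. g y \<noteq> -\<infinity>"
    using proper by (auto simp: proper_fun_def)
  have "g p \<noteq> \<infinity>" "g q \<noteq> \<infinity>"
    using p[of x0] q[of x0] x0 by auto
  then obtain c d where c: "g p = ereal c" and d: "g q = ereal d"
    using fin by (metis ereal_cases)
  have "0 \<le> (1 / \<gamma>) * (inner (p - a) (q - p) + inner (q - b) (p - q))"
    using proximal_point_variational_inequality[OF cvx \<gamma> p c d]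
      proximal_point_variational_inequality[OF cvx \<gamma> q d c]
    by (simp add: distrib_left)
  then have "0 \<le> inner (p - a) (q - p) + inner (q - b) (p - q)"
    using \<gamma> by (simp add: zero_le_mult_iff zero_le_divide_iff)
  also have "\<dots> = inner (a - b) (p - q) - (norm (p - q))\<^sup>2"
    by (simp add: power2_norm_eq_inner inner_diff_left inner_diff_right inner_commute)
  finally have "norm (p - q) * norm (p - q) \<le> inner (a - b) (p - q)"
    by (simp add: power2_eq_square)
  also have "\<dots> \<le> norm (a - b) * norm (p - q)"
    by (rule norm_cauchy_schwarz)
  finally show ?thesis
    by (cases "p = q") (auto simp: dist_norm)
qed

lemma prox_minimises:
  assumes "convex_fun g" and "proper_fun g" and "lsc_fun g" and "\<gamma> > 0"
  shows "g (prox \<gamma> g a) + ereal (1 / (2 * \<gamma>) * (norm (prox \<gamma> g a - a))\<^sup>2)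
    \<le> g y + ereal (1 / (2 * \<gamma>) * (norm (y - a))\<^sup>2)"
proof -
  let ?f = "\<lambda>y. g y + ereal (1 / (2 * \<gamma>) * (norm (y - a))\<^sup>2)"
  have "\<exists>p. is_arg_min ?f (\<lambda>_. True) p"
    using prox_objective_has_minimiser[OF assms] by (simp add: is_arg_min_linorder)
  then have "is_arg_min ?f (\<lambda>_. True) (prox \<gamma> g a)"
    unfolding prox_def arg_min_def by (rule someI_ex)
  then show ?thesis
    by (simp add: is_arg_min_linorder)
qed

lemma continuous_on_prox:
  assumes "convex_fun g" and "proper_fun g" and "lsc_fun g" and "\<gamma> > 0"
  shows "continuous_on UNIV (prox \<gamma> g)"
proof (rule lipschitz_on_continuous_on)
  show "1-lipschitz_on UNIV (prox \<gamma> g)"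
    using proximal_points_nonexpansive[OF assms(1,2,4) prox_minimises[OF assms]
        prox_minimises[OF assms]]
    by (intro lipschitz_onI) auto
qed

section \<open>Sparsity vectors along convergent sequences\<close>

text \<open>Lower semicontinuity of the sparsity vector: membership in a closed set can be gained in the
  limit, but not lost.\<close>

lemma eventually_sparsity_ge:
  fixes \<M> :: "'m::finite \<Rightarrow> (real ^ 'n) set"
  assumes "\<And>i. closed (\<M> i)" and "(x \<longlongrightarrow> l) F"
  shows "\<forall>\<^sub>F k in F. sparsity \<M> l \<le> sparsity \<M> (x k)"
proof -
  have "\<forall>\<^sub>F k in F. \<forall>i. l \<notin> \<M> i \<longrightarrow> x k \<notin> \<M> i"
  proof (rule eventually_all_finite)
    fix i
    show "\<forall>\<^sub>F k in F. l \<notin> \<M> i \<longrightarrow> x k \<notin> \<M> i"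
      using topological_tendstoD[OF assms(2), of "- \<M> i"] assms(1)[of i]
      by (cases "l \<in> \<M> i") (auto simp: open_Compl)
  qed
  then show ?thesis
    by eventually_elim (auto simp: sparsity_def less_eq_vec_def)
qed

lemma sparsity_le_sparsity_Union:
  assumes "sparsity \<M> x \<in> A"
  shows "sparsity \<M> x \<le> sparsity_Union A"
  using assms by (force simp: sparsity_Union_def sparsity_def less_eq_vec_def)

theorem theorem4:
  fixes g :: "real ^ 'n \<Rightarrow> ereal"
    and \<gamma> :: real
    and \<M> :: "'m::finite \<Rightarrow> (real ^ 'n) set"
    and P :: "'w measure"
    and u :: "nat \<Rightarrow> 'w \<Rightarrow> real ^ 'n"
    and u_star :: "'w \<Rightarrow> real ^ 'n"
    and x :: "nat \<Rightarrow> 'w \<Rightarrow> real ^ 'n"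
    and x_star :: "'w \<Rightarrow> real ^ 'n"
  assumes "convex_fun g" and "proper_fun g" and "lsc_fun g"
    and "\<gamma> > 0"
    and "\<And>i. subspace (\<M> i)"
    and "prob_space P"
    and "\<And>k. u k \<in> borel_measurable P"
    and "u_star \<in> borel_measurable P"
    and "AE \<omega> in P. (\<lambda>k. u k \<omega>) \<longlonglongrightarrow> u_star \<omega>"
    and "\<And>k \<omega>. x k \<omega> = prox \<gamma> g (u k \<omega>)"
    and "\<And>\<omega>. x_star \<omega> = prox \<gamma> g (u_star \<omega>)"
  shows "\<forall>\<epsilon>>0. AE \<omega> in P. \<forall>\<^sub>F k in sequentially.
    sparsity \<M> (x_star \<omega>) \<le> sparsity \<M> (x k \<omega>) \<and>
    sparsity \<M> (x k \<omega>)
      \<le> sparsity_Union ((\<lambda>v. sparsity \<M> (prox \<gamma> g v)) ` ball (u_star \<omega>) \<epsilon>)"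
proof (intro allI impI)
  fix \<epsilon> :: real assume \<epsilon>: "\<epsilon> > 0"
  show "AE \<omega> in P. \<forall>\<^sub>F k in sequentially.
    sparsity \<M> (x_star \<omega>) \<le> sparsity \<M> (x k \<omega>) \<and>
    sparsity \<M> (x k \<omega>)
      \<le> sparsity_Union ((\<lambda>v. sparsity \<M> (prox \<gamma> g v)) ` ball (u_star \<omega>) \<epsilon>)"
    using assms(9)
  proof eventually_elim
    case (elim \<omega>)
    have "(\<lambda>k. x k \<omega>) \<longlonglongrightarrow> x_star \<omega>"
      unfolding assms(10,11)
      by (rule continuous_on_tendsto_compose[OF continuous_on_prox[OF assms(1-4)] elim]) auto
    then have "\<forall>\<^sub>F k in sequentially. sparsity \<M> (x_star \<omega>) \<le> sparsity \<M> (x k \<omega>)"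
      by (rule eventually_sparsity_ge[OF closed_subspace[OF assms(5)]])
    moreover have "\<forall>\<^sub>F k in sequentially. u k \<omega> \<in> ball (u_star \<omega>) \<epsilon>"
      by (rule topological_tendstoD[OF elim]) (use \<epsilon> in auto)
    then have "\<forall>\<^sub>F k in sequentially. sparsity \<M> (x k \<omega>)
        \<le> sparsity_Union ((\<lambda>v. sparsity \<M> (prox \<gamma> g v)) ` ball (u_star \<omega>) \<epsilon>)"
      unfolding assms(10) by eventually_elim (rule sparsity_le_sparsity_Union, blast)
    ultimately show ?case
      by eventually_elim simp
  qed
qed

end
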